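(* Let $\omega_1,\omega_2>0$ be real numbers with $\alpha=\omega_1/\omega_2$ irrational, and put $T_2=2\pi/\omega_2$. Then there exist continuous functions $\bar h_0,\bar h_1,\bar h_2,\bar h_3:\mathbb{R}^2\to\mathbb{R}$, $2\pi$-periodic in each of the two arguments, such that the quasiperiodic Hamiltonians acting on $\mathcal{H}=\mathbb{C}^2$, $$H_\theta(t)=h_0(t)I+\sum_{j=1}^3h_j(t)\sigma_j,\qquad h_j(t)=\bar h_j(\omega_1t+\theta_1,\omega_2t+\theta_2),\quad \theta=(\theta_1,\theta_2),$$ with propagators $U_\theta(t,s)$, have monodromy operator $$U_{(\theta_1,0)}(T_2,0)=\begin{pmatrix}e^{i\theta_1}&0\\0&e^{-i\theta_1}\end{pmatrix}\quad\text{for all }\theta_1,$$ and for every $\theta_1$ and every $0\neq\xi\in\mathbb{C}^2$ the orbit $\{U_{(\theta_1,0)}(t,0)\xi:t\in\mathbb{R}\}$ is precompact but the function $t\mapsto U_{(\theta_1,0)}(t,0)\xi$ is not almost periodic.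
   Context: $\sigma_1,\sigma_2,\sigma_3$ are the Pauli matrices and $I$ is the identity. $U_\theta(t,s)$ is the unitary propagator of the Schrödinger equation $i\,\partial_tU_\theta(t,s)=H_\theta(t)U_\theta(t,s)$, $U_\theta(s,s)=I$. A continuous function $f:\mathbb{R}\to\mathcal{B}$ ($\mathcal{B}$ a Banach space) is almost periodic if for every $\epsilon>0$ there is $l(\epsilon)>0$ such that every interval of length $l(\epsilon)$ contains a point $\tau$ with $\|f(t+\tau)-f(t)\|<\epsilon$ for all $t\in\mathbb{R}$. *)

theory Defs
  imports "HOL-Analysis.Analysis"
begin

definition pauli1 :: "complex^2^2" where
  "pauli1 = vector [vector [0, 1], vector [1, 0]]"

definition pauli2 :: "complex^2^2" where
  "pauli2 = vector [vector [0, - \<i>], vector [\<i>, 0]]"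

definition pauli3 :: "complex^2^2" where
  "pauli3 = vector [vector [1, 0], vector [0, - 1]]"

definition cadjoint :: "complex^'n^'n \<Rightarrow> complex^'n^'n" where
  "cadjoint A = (\<chi> i j. cnj (A $ j $ i))"

definition unitary_matrix :: "complex^'n^'n \<Rightarrow> bool" where
  "unitary_matrix A \<longleftrightarrow> cadjoint A ** A = mat 1 \<and> A ** cadjoint A = mat 1"

(* The factor "mat \<i>" is \<i> times the identity, so the equation reads i dU/dt = H U.
   For continuous H these conditions determine U uniquely. *)
definition unitary_propagator ::
  "(real \<Rightarrow> complex^'n^'n) \<Rightarrow> (real \<Rightarrow> real \<Rightarrow> complex^'n^'n) \<Rightarrow> bool" where
  "unitary_propagator H U \<longleftrightarrow>
     (\<forall>t s. unitary_matrix (U t s)) \<and>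
     (\<forall>s. U s s = mat 1) \<and>
     (\<forall>t s. \<exists>D. ((\<lambda>r. U r s) has_vector_derivative D) (at t) \<and>
                mat \<i> ** D = H t ** U t s)"

definition torus_function :: "(real \<times> real \<Rightarrow> real) \<Rightarrow> bool" where
  "torus_function h \<longleftrightarrow> continuous_on UNIV h \<and>
     (\<forall>x y. h (x + 2 * pi, y) = h (x, y) \<and> h (x, y + 2 * pi) = h (x, y))"

definition quasiperiodic_hamiltonian ::
  "(real \<times> real \<Rightarrow> real) \<Rightarrow> (real \<times> real \<Rightarrow> real) \<Rightarrow>
   (real \<times> real \<Rightarrow> real) \<Rightarrow> (real \<times> real \<Rightarrow> real) \<Rightarrow>
   real \<Rightarrow> real \<Rightarrow> real \<times> real \<Rightarrow> real \<Rightarrow> complex^2^2" where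
  "quasiperiodic_hamiltonian h0 h1 h2 h3 \<omega>1 \<omega>2 \<theta> t =
     (let p = (\<omega>1 * t + fst \<theta>, \<omega>2 * t + snd \<theta>)
      in h0 p *\<^sub>R mat 1 + h1 p *\<^sub>R pauli1 + h2 p *\<^sub>R pauli2 + h3 p *\<^sub>R pauli3)"

definition almost_periodic :: "(real \<Rightarrow> 'a::banach) \<Rightarrow> bool" where
  "almost_periodic f \<longleftrightarrow> continuous_on UNIV f \<and>
     (\<forall>\<epsilon>>0. \<exists>l>0. \<forall>a. \<exists>\<tau>\<in>{a..a + l}. \<forall>t. norm (f (t + \<tau>) - f t) < \<epsilon>)"

definition precompact :: "'a::topological_space set \<Rightarrow> bool" where
  "precompact S \<longleftrightarrow> compact (closure S)"

end

theory Submission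
  imports Defs
begin

text \<open>In every period of the second angle the Hamiltonian applies two pulses, one about the axis
  \<open>\<sigma>\<^sub>1\<close> and one about an axis in the \<open>\<sigma>\<^sub>1\<sigma>\<^sub>2\<close>-plane whose direction is the value \<open>\<theta>\<^sub>1\<close> of the first
  angle at the beginning of the period. Each is a rotation by \<open>\<pi>\<close>, and their product is
  \<open>diag (cis \<theta>\<^sub>1) (cis (- \<theta>\<^sub>1))\<close>. Since \<open>\<theta>\<^sub>1\<close> increases by \<open>2\<pi>\<alpha>\<close> per period, the propagator over
  \<open>n\<close> periods has the quadratic phase \<open>n\<theta>\<^sub>1 + \<pi>\<alpha>n(n - 1)\<close>. An almost periodic orbit would have an almost
  period that is a nonzero multiple \<open>p\<close> of the period, but the phases at \<open>k + p\<close> and \<open>k\<close> differ by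
  \<open>2\<pi>\<alpha>pk\<close> up to a constant, which is not nearly constant in \<open>k\<close>.\<close>

section \<open>Almost periods that are multiples of a given number\<close>

text \<open>One almost period carries two close points into a fixed compact interval, where
  Heine-Cantor applies.\<close>

lemma almost_periodic_uniformly_continuous:
  fixes f :: "real \<Rightarrow> 'a::banach"
  assumes f: "almost_periodic f"
  shows "uniformly_continuous_on UNIV f"
  unfolding uniformly_continuous_on_def
proof (intro allI impI)
  fix e :: real assume e: "0 < e"
  from f e obtain l where l: "l > 0"
    and ap: "\<And>a. \<exists>\<tau>\<in>{a..a + l}. \<forall>t. norm (f (t + \<tau>) - f t) < e / 3"
    unfolding almost_periodic_def by (meson divide_pos_pos zero_less_numeral)
  \<comment> \<open>The margin \<open>1\<close> on both sides leaves room for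
    \<open>y + \<tau>\<close>: below, \<open>x + \<tau>\<close> lies in \<open>{0..l}\<close> and
    \<open>y\<close> is within \<open>1\<close> of \<open>x\<close>.\<close>
  have "continuous_on {-1..l + 1} f"
    using f continuous_on_subset unfolding almost_periodic_def by blast
  then have "uniformly_continuous_on {-1..l + 1} f"
    by (rule compact_uniformly_continuous) simp
  then obtain d where d: "d > 0"
    and uc: "\<And>x y. \<lbrakk>x \<in> {-1..l + 1}; y \<in> {-1..l + 1}; dist y x < d\<rbrakk> \<Longrightarrow> dist (f y) (f x) < e / 3"
    using e unfolding uniformly_continuous_on_def by (metis divide_pos_pos zero_less_numeral)
  show "\<exists>d>0. \<forall>x\<in>UNIV. \<forall>y\<in>UNIV. dist y x < d \<longrightarrow> dist (f y) (f x) < e"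
  proof (intro exI[of _ "min d 1"] conjI ballI impI)
    show "min d 1 > 0" using d by simp
    fix x y :: real assume xy: "dist y x < min d 1"
    obtain \<tau> where \<tau>: "\<tau> \<in> {- x..- x + l}" and per: "\<And>t. norm (f (t + \<tau>) - f t) < e / 3"
      using ap[of "- x"] by blast
    have "x + \<tau> \<in> {-1..l + 1}" "y + \<tau> \<in> {-1..l + 1}" "dist (y + \<tau>) (x + \<tau>) < d"
      using \<tau> xy by (auto simp: dist_real_def)
    then have "dist (f (y + \<tau>)) (f (x + \<tau>)) < e / 3" by (rule uc)
    moreover have "dist (f (y + \<tau>)) (f y) < e / 3" "dist (f (x + \<tau>)) (f x) < e / 3"
      using per by (simp_all add: dist_norm)
    moreover have "dist (f y) (f x)
        \<le> dist (f (y + \<tau>)) (f y) + dist (f (y + \<tau>)) (f (x + \<tau>)) + dist (f (x + \<tau>)) (f x)"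
      by (smt (verit) dist_commute dist_triangle)
    ultimately show "dist (f y) (f x) < e" by linarith
  qed
qed

text \<open>Almost periods taken from the intervals starting at \<open>n * T\<close> exceed \<open>n * T\<close> by a bounded
  amount, so two of these excesses nearly coincide; the difference of the two almost periods is then
  close to a multiple of \<open>T\<close>.\<close>
lemma almost_periodic_obtain_multiple:
  fixes f :: "real \<Rightarrow> 'a::banach" and T :: real
  assumes f: "almost_periodic f" and e: "e > 0"
  obtains p :: int where "p \<noteq> 0" "\<And>t. norm (f (t + of_int p * T) - f t) < e"
proof -
  from f e obtain l where l: "l > 0"
    and ap: "\<And>a. \<exists>\<tau>\<in>{a..a + l}. \<forall>t. norm (f (t + \<tau>) - f t) < e / 3"
    unfolding almost_periodic_def by (meson divide_pos_pos zero_less_numeral)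
  obtain d where d: "d > 0" and uc: "\<And>x y. dist y x < d \<Longrightarrow> dist (f y) (f x) < e / 3"
    using almost_periodic_uniformly_continuous[OF f] e
    unfolding uniformly_continuous_on_def by (metis UNIV_I divide_pos_pos zero_less_numeral)
  obtain \<sigma> where \<sigma>: "\<And>a. \<sigma> a \<in> {a..a + l}" "\<And>a t. norm (f (t + \<sigma> a) - f t) < e / 3"
    using ap by metis
  define \<tau> where "\<tau> n = \<sigma> (n * T)" for n :: nat
  have \<tau>: "\<tau> n \<in> {n * T..n * T + l}" and per: "norm (f (t + \<tau> n) - f t) < e / 3" for n t
    using \<sigma> by (simp_all only: \<tau>_def)
  define s where "s n = \<tau> n - n * T" for n :: nat
  have "s n \<in> {0..l}" for n using \<tau>[of n] by (auto simp: s_def)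
  then have "\<exists>L\<in>{0..l}. \<exists>r. strict_mono r \<and> (s \<circ> r) \<longlonglongrightarrow> L"
    by (meson compact_Icc compact_imp_seq_compact seq_compactE)
  then obtain r where r: "strict_mono (r :: nat \<Rightarrow> nat)" and "Cauchy (s \<circ> r)"
    using LIMSEQ_imp_Cauchy by blast
  then obtain M where M: "\<And>m n. \<lbrakk>m \<ge> M; n \<ge> M\<rbrakk> \<Longrightarrow> dist (s (r m)) (s (r n)) < d"
    using d unfolding Cauchy_def by fastforce
  define m where "m = r M"
  define n where "n = r (Suc M)"
  \<comment> \<open>Strict monotonicity of the subsequence is what makes the multiplier
    nonzero.\<close>
  have "m < n" using r by (simp add: m_def n_def strict_mono_less)
  have close: "\<bar>s n - s m\<bar> < d" using M[of "Suc M" M] by (simp add: m_def n_def dist_real_def)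
  show ?thesis
  proof (rule that[of "int n - int m"])
    show "int n - int m \<noteq> 0" using \<open>m < n\<close> by simp
    fix t
    \<comment> \<open>Replacing \<open>(n - m) * T\<close> by \<open>\<tau> n - \<tau> m\<close>
      moves the argument by less than \<open>d\<close>; then the almost periods
      \<open>\<tau> n\<close> and \<open>\<tau> m\<close> are removed one at a time.\<close>
    have "dist (f (t + (real n - real m) * T)) (f (t - \<tau> m + \<tau> n)) < e / 3"
      by (rule uc) (use close in \<open>simp add: s_def dist_real_def algebra_simps\<close>)
    moreover have "dist (f (t - \<tau> m + \<tau> n)) (f (t - \<tau> m)) < e / 3"
      using per by (simp add: dist_norm)
    moreover have "dist (f (t - \<tau> m)) (f t) < e / 3"
      using per[of "t - \<tau> m" m] by (simp add: dist_norm norm_minus_commute)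
    ultimately have "dist (f (t + (real n - real m) * T)) (f t) < e"
      by (rule dist_triangle_third)
    then show "norm (f (t + of_int (int n - int m) * T) - f t) < e"
      by (simp add: dist_norm)
  qed
qed

text \<open>A power \<open>w ^ 2 ^ j\<close> with \<open>\<bar>w ^ 2 ^ j - 1\<bar> < 1/2\<close> has \<open>\<bar>w ^ 2 ^ j + 1\<bar> > 3/2\<close>, so each squaring
  expands the distance to \<open>1\<close> by the factor \<open>3/2\<close>.\<close>
lemma powers_near_one_imp_one:
  fixes w :: complex
  assumes near: "\<And>k::nat. norm (w ^ k - 1) < 1/2"
  shows "w = 1"
proof (rule ccontr)
  assume "w \<noteq> 1"
  have grow: "(3/2) ^ j * norm (w - 1) \<le> norm (w ^ 2 ^ j - 1)" for j
  proof (induction j)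
    case 0 then show ?case by simp
  next
    case (Suc j)
    let ?v = "w ^ 2 ^ j"
    have "norm (2::complex) \<le> norm (?v + 1) + norm (?v - 1)"
      using norm_triangle_ineq4[of "?v + 1" "?v - 1"] by simp
    then have plus: "norm (?v + 1) \<ge> 3/2" using near[of "2 ^ j"] by simp
    have "w ^ 2 ^ Suc j - 1 = (?v + 1) * (?v - 1)"
      by (simp add: algebra_simps power2_eq_square flip: power_mult)
         (metis mult_2 power_add)
    then have "norm (w ^ 2 ^ Suc j - 1) = norm (?v + 1) * norm (?v - 1)"
      by (simp add: norm_mult)
    moreover have "norm (?v + 1) * norm (?v - 1) \<ge> 3/2 * norm (?v - 1)"
      using plus by (rule mult_right_mono) simp
    ultimately show ?case using Suc by simp
  qed
  obtain j where "1 / norm (w - 1) < (3/2) ^ j"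
    using real_arch_pow[of "3/2"] by auto
  then have "1 < (3/2) ^ j * norm (w - 1)" using \<open>w \<noteq> 1\<close> by (simp add: field_simps)
  with grow[of j] near[of "2 ^ j"] show False by simp
qed

section \<open>A differentiable ramp\<close>

text \<open>A hat on \<open>[0, 2]\<close> with peak \<open>1\<close> and integral \<open>1\<close>.
  Positive parts are used because halving their squares gives the antiderivative \<open>ramp\<close>
  in closed form.\<close>

definition tent :: "real \<Rightarrow> real" where
  "tent r = max 0 r - 2 * max 0 (r - 1) + max 0 (r - 2)"

definition ramp :: "real \<Rightarrow> real" where
  "ramp r = ((max 0 r)\<^sup>2 - 2 * (max 0 (r - 1))\<^sup>2 + (max 0 (r - 2))\<^sup>2) / 2"

lemma tent_eq_0: "r \<le> 0 \<or> 2 \<le> r \<Longrightarrow> tent r = 0"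
  by (auto simp: tent_def)

lemma ramp_eq_0: "r \<le> 0 \<Longrightarrow> ramp r = 0"
  by (simp add: ramp_def)

lemma ramp_eq_1: "2 \<le> r \<Longrightarrow> ramp r = 1"
  by (simp add: ramp_def power2_eq_square algebra_simps)

lemma continuous_tent: "continuous_on S tent"
  unfolding tent_def by (intro continuous_intros)

text \<open>Squaring removes the kink of the positive part: at \<open>0\<close> the difference
  quotient is at most \<open>\<bar>h\<bar>\<close>.\<close>

lemma DERIV_max_0_squared: "((\<lambda>r::real. (max 0 r)\<^sup>2) has_real_derivative 2 * max 0 x) (at x)"
proof (cases x "0 :: real" rule: linorder_cases)
  case less
  have "((\<lambda>r::real. 0) has_real_derivative 2 * max 0 x) (at x)"
    using less by simp
  then show ?thesis
    by (rule has_field_derivative_transform_within_open[where S = "{..<0}"]) (use less in auto)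
next
  case greater
  have "((\<lambda>r::real. r\<^sup>2) has_real_derivative 2 * max 0 x) (at x)"
    using greater by (auto intro!: derivative_eq_intros)
  then show ?thesis
    by (rule has_field_derivative_transform_within_open[where S = "{0<..}"]) (use greater in auto)
next
  case equal
  have "(\<lambda>h::real. (max 0 h)\<^sup>2 / h) \<midarrow>0\<rightarrow> 0"
  proof (rule Lim_null_comparison)
    show "\<forall>\<^sub>F h::real in at 0. norm ((max 0 h)\<^sup>2 / h) \<le> \<bar>h\<bar>"
      by (rule eventuallyI) (auto simp: max_def power2_eq_square)
    show "(\<lambda>h::real. \<bar>h\<bar>) \<midarrow>0\<rightarrow> 0" by (intro tendsto_eq_intros) auto
  qed
  then show ?thesis by (simp add: equal DERIV_def)
qed

lemma DERIV_ramp: "(ramp has_real_derivative tent x) (at x)"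
proof -
  have shifted: "((\<lambda>r. (max 0 (r - c))\<^sup>2) has_real_derivative 2 * max 0 (x - c)) (at x)" for c
    using DERIV_max_0_squared[of "x + - c"] by (subst (asm) DERIV_shift) simp
  have "((\<lambda>r. ((max 0 r)\<^sup>2 - 2 * (max 0 (r - 1))\<^sup>2 + (max 0 (r - 2))\<^sup>2) / 2) has_real_derivative
      (2 * max 0 x - 2 * (2 * max 0 (x - 1)) + 2 * max 0 (x - 2)) / 2) (at x)"
    by (intro DERIV_cdivide DERIV_add DERIV_diff DERIV_cmult shifted DERIV_max_0_squared)
  then show ?thesis by (simp add: ramp_def[abs_def] tent_def diff_divide_distrib add_divide_distrib)
qed

section \<open>Matrices of quaternion type\<close>

text \<open>For unit columns \<open>(a, b)\<close> these are the elements of SU(2). The first column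
  determines the matrix, so the Schroedinger equation reduces to two scalar equations.\<close>

definition quat_matrix :: "complex \<Rightarrow> complex \<Rightarrow> complex^2^2" where
  "quat_matrix a b = vector [vector [a, - cnj b], vector [b, cnj a]]"

lemma quat_matrix_mult:
  "quat_matrix a b ** quat_matrix c d = quat_matrix (a * c - cnj b * d) (b * c + cnj a * d)"
  by (simp add: quat_matrix_def matrix_matrix_mult_def vec_eq_iff forall_2 sum_2 algebra_simps)

lemma cadjoint_quat_matrix: "cadjoint (quat_matrix a b) = quat_matrix (cnj a) (- b)"
  by (simp add: quat_matrix_def cadjoint_def vec_eq_iff forall_2)

lemma quat_matrix_1_0: "quat_matrix 1 0 = mat 1"
  by (simp add: quat_matrix_def mat_def vec_eq_iff forall_2)

lemma quat_matrix_mult_cadjoint: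
  assumes "(norm a)\<^sup>2 + (norm b)\<^sup>2 = 1"
  shows "quat_matrix a b ** cadjoint (quat_matrix a b) = mat 1"
    and "cadjoint (quat_matrix a b) ** quat_matrix a b = mat 1"
proof -
  have "a * cnj a + b * cnj b = of_real ((norm a)\<^sup>2 + (norm b)\<^sup>2)"
    by (simp only: of_real_add complex_norm_square)
  then have "a * cnj a + b * cnj b = 1" using assms by simp
  then show "quat_matrix a b ** cadjoint (quat_matrix a b) = mat 1"
    and "cadjoint (quat_matrix a b) ** quat_matrix a b = mat 1"
    unfolding cadjoint_quat_matrix quat_matrix_mult quat_matrix_1_0[symmetric]
    by (simp_all add: mult.commute)
qed

lemma cadjoint_mult:
  fixes A :: "complex^'n^'n"
  shows "cadjoint (A ** B) = cadjoint B ** cadjoint A"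
  by (simp add: cadjoint_def matrix_matrix_mult_def vec_eq_iff mult.commute)

lemma cadjoint_cadjoint: "cadjoint (cadjoint A) = A"
  by (simp add: cadjoint_def vec_eq_iff)

lemma unitary_matrix_mult_cadjoint:
  fixes A B :: "complex^'n^'n"
  assumes "unitary_matrix A" "unitary_matrix B"
  shows "unitary_matrix (A ** cadjoint B)"
proof -
  have "cadjoint A ** A = mat 1" "A ** cadjoint A = mat 1"
       "cadjoint B ** B = mat 1" "B ** cadjoint B = mat 1"
    using assms by (auto simp: unitary_matrix_def)
  then show ?thesis
    unfolding unitary_matrix_def cadjoint_mult cadjoint_cadjoint
    by (metis matrix_mul_assoc matrix_mul_rid)
qed

text \<open>The conjugates make \<open>quat_matrix\<close> linear over the reals only, which is
  enough for derivatives in a real variable.\<close>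

lemma has_vector_derivative_quat_matrix:
  assumes "(a has_vector_derivative a') (at x within S)" "(b has_vector_derivative b') (at x within S)"
  shows "((\<lambda>x. quat_matrix (a x) (b x)) has_vector_derivative quat_matrix a' b') (at x within S)"
proof -
  have "linear (\<lambda>(a, b). quat_matrix a b)"
    by (rule linearI)
       (auto simp: quat_matrix_def vec_eq_iff forall_2)
  then have "bounded_linear (\<lambda>(a, b). quat_matrix a b)"
    by (simp add: linear_conv_bounded_linear)
  from bounded_linear.has_vector_derivative[OF this has_vector_derivative_Pair[OF assms]]
  show ?thesis by simp
qed

lemma has_vector_derivative_matrix_mult_right:
  fixes A :: "real \<Rightarrow> complex^'n^'m" and B :: "complex^'k^'n"
  assumes "(A has_vector_derivative A') F"
  shows "((\<lambda>x. A x ** B) has_vector_derivative A' ** B) F"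
proof -
  have "linear (\<lambda>X :: complex^'n^'m. X ** B)"
    by (rule linearI)
       (simp_all add: matrix_matrix_mult_def vec_eq_iff sum.distrib
          distrib_right scaleR_right.sum)
  then have "bounded_linear (\<lambda>X :: complex^'n^'m. X ** B)"
    by (simp add: linear_conv_bounded_linear)
  from bounded_linear.has_vector_derivative[OF this assms] show ?thesis .
qed

text \<open>The Hamiltonian has zero diagonal and off-diagonal entries \<open>cnj h\<close> and
  \<open>h\<close>. The hypotheses are the first column of the equation; conjugating them gives the
  second.\<close>

lemma schroedinger_quat_matrix:
  assumes "a' = - \<i> * cnj h * b" "b' = - \<i> * h * a"
  shows "mat \<i> ** quat_matrix a' b'
    = (0 *\<^sub>R mat 1 + Re h *\<^sub>R pauli1 + Im h *\<^sub>R pauli2 + 0 *\<^sub>R pauli3) ** quat_matrix a b"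
proof -
  have "h = of_real (Re h) + \<i> * of_real (Im h)" by (rule complex_eq)
  moreover have "cnj h = of_real (Re h) - \<i> * of_real (Im h)" by (simp add: complex_eq_iff)
  ultimately show ?thesis
    using assms
    by (simp add: quat_matrix_def matrix_matrix_mult_def mat_def pauli1_def pauli2_def
        vec_eq_iff forall_2 sum_2 algebra_simps complex_eq_iff)
qed

section \<open>The two pulses\<close>

text \<open>Each period has length 6 in the variable \<open>offset\<close>, with pulses on \<open>[1, 3]\<close> and \<open>[3, 5]\<close>. The field
  thus vanishes near the joints of the periods, where the solution is locally constant.\<close>
definition offset :: "int \<Rightarrow> real \<Rightarrow> real" where
  "offset n y = 3 * y / pi - 6 * of_int n"

definition period :: "real \<Rightarrow> int" where
  "period y = \<lfloor>y / (2 * pi)\<rfloor>"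

lemma period_eqI: "0 \<le> offset n y \<Longrightarrow> offset n y < 6 \<Longrightarrow> period y = n"
  unfolding period_def offset_def by (rule floor_unique) (auto simp: field_simps)

text \<open>Period interiors and neighbourhoods of joints form an open cover on each member of which
  a single formula holds, so continuity and derivatives can be checked locally.\<close>

lemma offset_cases:
  obtains (inner) n where "0 < offset n y" "offset n y < 6"
  | (joint) n where "- 1 < offset n y" "offset n y < 1"
proof -
  define n where "n = \<lfloor>y / (2 * pi)\<rfloor>"
  have "of_int n \<le> y / (2 * pi)" "y / (2 * pi) < of_int n + 1"
    unfolding n_def by linarith+
  then have "0 \<le> offset n y" "offset n y < 6"
    by (auto simp: offset_def field_simps)
  then show ?thesis
    using inner[of n] joint[of n] by (cases "offset n y = 0") auto
qed

lemma continuous_offset [continuous_intros]: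
  "continuous_on S f \<Longrightarrow> continuous_on S (\<lambda>x. offset n (f x))"
  unfolding offset_def by (intro continuous_intros) auto

lemma offset_pred: "offset (n - 1) y = offset n y + 6"
  by (simp add: offset_def)

text \<open>The Hamiltonian with off-diagonal entry \<open>h = h1 + \<i> * h2\<close>. Its first pulse is about the
  fixed axis \<open>\<sigma>\<^sub>1\<close>; the axis of the second one is given by \<open>x - \<alpha> * (y - 2 * pi * n)\<close>, the value
  of \<open>x\<close> at the beginning \<open>y = 2 * pi * n\<close> of the current period.\<close>
definition pulses :: "real \<Rightarrow> int \<Rightarrow> real \<times> real \<Rightarrow> complex" where
  "pulses \<alpha> n p = of_real (3/2) *
    (of_real (tent (offset n (snd p) - 1))
     - of_real (tent (offset n (snd p) - 3)) * cis (- (fst p - \<alpha> * (snd p - 2 * pi * of_int n))))"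

definition field :: "real \<Rightarrow> real \<times> real \<Rightarrow> complex" where
  "field \<alpha> p = pulses \<alpha> (period (snd p)) p"

lemma field_inner: "0 < offset n (snd p) \<Longrightarrow> offset n (snd p) < 6 \<Longrightarrow> field \<alpha> p = pulses \<alpha> n p"
  using period_eqI[of n "snd p"] by (simp add: field_def)

text \<open>The pulses occupy offsets from \<open>1\<close> to \<open>5\<close>. Left of the joint
  \<open>period\<close> is still \<open>n - 1\<close>, and the offset counted from there exceeds
  \<open>5\<close>.\<close>

lemma field_joint:
  assumes "- 1 < offset n (snd p)" "offset n (snd p) < 1"
  shows "field \<alpha> p = 0"
proof (cases "offset n (snd p) \<ge> 0")
  case True
  then have "period (snd p) = n" using assms by (intro period_eqI) auto
  then show ?thesis using assms by (simp add: field_def pulses_def tent_eq_0)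
next
  case False
  then have "period (snd p) = n - 1" using assms by (intro period_eqI) (auto simp: offset_pred)
  then show ?thesis using assms False by (simp add: field_def pulses_def tent_eq_0 offset_pred)
qed

text \<open>The jumps of \<open>period\<close> do no harm: near them the field is zero, and
  elsewhere it agrees locally with one continuous \<open>pulses \<alpha> n\<close>.\<close>

lemma continuous_field: "continuous_on UNIV (field \<alpha>)"
proof -
  define A where "A n = {p :: real \<times> real. 0 < offset n (snd p) \<and> offset n (snd p) < 6}" for n
  define B where "B n = {p :: real \<times> real. - 1 < offset n (snd p) \<and> offset n (snd p) < 1}" for n
  have op: "open (A n)" "open (B n)" for n
    unfolding A_def B_def by (intro open_Collect_conj open_Collect_less continuous_intros)+
  have "continuous_on (A n) (pulses \<alpha> n)" for n
    unfolding pulses_def by (intro continuous_intros continuous_on_compose2[OF continuous_tent[of UNIV]]) auto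
  then have contA: "continuous_on (A n) (field \<alpha>)" for n
    by (rule continuous_on_eq) (auto simp: A_def field_inner)
  have "continuous_on (B n) (\<lambda>_. 0 :: complex)" for n by simp
  then have contB: "continuous_on (B n) (field \<alpha>)" for n
    by (rule continuous_on_eq) (auto simp: B_def field_joint)
  have "p \<in> \<Union>(range A \<union> range B)" for p
    by (cases rule: offset_cases[of "snd p"]) (auto simp: A_def B_def)
  then have "\<Union>(range A \<union> range B) = UNIV" by blast
  moreover have "continuous_on (\<Union>(range A \<union> range B)) (field \<alpha>)"
    by (rule continuous_on_open_Union) (use op contA contB in auto)
  ultimately show ?thesis by simp
qed

text \<open>Shifting \<open>y\<close> by \<open>2 * pi\<close> raises \<open>period\<close> by one,
  which leaves both the offset and the time since the start of the period unchanged.\<close>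

lemma field_periodic:
  "field \<alpha> (x + 2 * pi, y) = field \<alpha> (x, y)"
  "field \<alpha> (x, y + 2 * pi) = field \<alpha> (x, y)"
proof -
  have "x + 2 * pi - c = (x - c) + 2 * pi" for c by simp
  then have "cis (- (x + 2 * pi - c)) = cis (- (x - c))" for c
    by (simp only: cis.ctr cos_minus sin_minus cos_periodic sin_periodic)
  then show "field \<alpha> (x + 2 * pi, y) = field \<alpha> (x, y)"
    by (simp add: field_def pulses_def)
  have "(y + 2 * pi) / (2 * pi) = y / (2 * pi) + 1" by (simp add: field_simps)
  then have "period (y + 2 * pi) = period y + 1" by (simp add: period_def)
  moreover have "offset (n + 1) (y + 2 * pi) = offset n y" for n
    by (simp add: offset_def field_simps)
  moreover have "y + 2 * pi - 2 * pi * of_int (n + 1) = y - 2 * pi * of_int n" for n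
    by (simp add: algebra_simps)
  ultimately show "field \<alpha> (x, y + 2 * pi) = field \<alpha> (x, y)"
    by (simp only: field_def pulses_def fst_conv snd_conv)
qed

section \<open>The solution\<close>

text \<open>The diagonal entry accumulated in \<open>n\<close> periods: period \<open>k\<close> starts at \<open>x = u + 2 * pi * \<alpha> * k\<close>
  and contributes the factor \<open>cis (u + 2 * pi * \<alpha> * k)\<close>.\<close>
definition phase :: "real \<Rightarrow> real \<Rightarrow> int \<Rightarrow> complex" where
  "phase \<alpha> u n = cis (of_int n * u + pi * \<alpha> * of_int n * (of_int n - 1))"

lemma phase_pred: "phase \<alpha> u n = phase \<alpha> u (n - 1) * cis (u + 2 * pi * \<alpha> * of_int (n - 1))"
  by (simp add: phase_def cis_mult algebra_simps)

text \<open>Half the rotation angle of the pulse starting at offset \<open>d\<close>: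
  \<open>exp (- \<i> * \<phi> * \<sigma>)\<close> rotates by \<open>2 * \<phi>\<close>, so a
  rotation by \<open>pi\<close> ends at \<open>pi / 2\<close>. Its slope produces the amplitude
  \<open>3/2\<close> in \<open>pulses\<close>.\<close>

definition angle :: "real \<Rightarrow> int \<Rightarrow> real \<Rightarrow> real" where
  "angle d n y = pi / 2 * ramp (offset n y - d)"

lemma DERIV_angle: "(angle d n has_real_derivative 3/2 * tent (offset n y - d)) (at y)"
proof -
  have "((\<lambda>y. offset n y - d) has_real_derivative 3 / pi) (at y)"
    unfolding offset_def by (auto intro!: derivative_eq_intros)
  from DERIV_cmult[OF DERIV_chain2[OF DERIV_ramp this], of "pi / 2"]
  show ?thesis by (simp add: angle_def[abs_def] mult.commute)
qed

lemma angle_eq_0: "offset n y \<le> d \<Longrightarrow> angle d n y = 0"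
  by (simp add: angle_def ramp_eq_0)

lemma angle_eq_pi_half: "d + 2 \<le> offset n y \<Longrightarrow> angle d n y = pi / 2"
  by (simp add: angle_def ramp_eq_1)

text \<open>Together with \<open>piece_snd\<close> this is the first column of the second rotation
  times the first rotation times the diagonal matrix accumulated before period
  \<open>n\<close>.\<close>

definition piece_fst :: "real \<Rightarrow> real \<Rightarrow> int \<Rightarrow> real \<Rightarrow> complex" where
  "piece_fst \<alpha> u n y =
     (of_real (cos (angle 1 n y) * cos (angle 3 n y))
      + of_real (sin (angle 1 n y) * sin (angle 3 n y)) * cis (u + 2 * pi * \<alpha> * of_int n))
     * phase \<alpha> u n"

definition piece_snd :: "real \<Rightarrow> real \<Rightarrow> int \<Rightarrow> real \<Rightarrow> complex" where
  "piece_snd \<alpha> u n y = \<i> *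
     (of_real (cos (angle 1 n y) * sin (angle 3 n y)) * cis (- (u + 2 * pi * \<alpha> * of_int n))
      - of_real (sin (angle 1 n y) * cos (angle 3 n y)))
     * phase \<alpha> u n"

definition state_fst :: "real \<Rightarrow> real \<Rightarrow> real \<Rightarrow> complex" where
  "state_fst \<alpha> u y = piece_fst \<alpha> u (period y) y"

definition state_snd :: "real \<Rightarrow> real \<Rightarrow> real \<Rightarrow> complex" where
  "state_snd \<alpha> u y = piece_snd \<alpha> u (period y) y"

text \<open>Right of the joint both angles are \<open>0\<close>. Left of it both are
  \<open>pi / 2\<close>, which leaves the factor that \<open>phase_pred\<close> absorbs into the
  next phase.\<close>

lemma state_joint:
  assumes "- 1 < offset n y" "offset n y < 1"
  shows "state_fst \<alpha> u y = phase \<alpha> u n" "state_snd \<alpha> u y = 0"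
proof -
  have "state_fst \<alpha> u y = phase \<alpha> u n \<and> state_snd \<alpha> u y = 0"
  proof (cases "offset n y \<ge> 0")
    case True
    then have "period y = n" using assms by (intro period_eqI) auto
    then show ?thesis using assms
      by (simp add: state_fst_def state_snd_def piece_fst_def piece_snd_def angle_eq_0)
  next
    case False
    then have "period y = n - 1" using assms by (intro period_eqI) (auto simp: offset_pred)
    moreover have "angle 1 (n - 1) y = pi / 2" "angle 3 (n - 1) y = pi / 2"
      using assms by (simp_all add: angle_eq_pi_half offset_pred)
    ultimately show ?thesis
      by (simp only: state_fst_def state_snd_def piece_fst_def piece_snd_def)
         (simp add: phase_pred[of \<alpha> u n])
  qed
  then show "state_fst \<alpha> u y = phase \<alpha> u n" "state_snd \<alpha> u y = 0" by auto
qed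

lemma state_norm: "(norm (state_fst \<alpha> u y))\<^sup>2 + (norm (state_snd \<alpha> u y))\<^sup>2 = 1"
proof -
  \<comment> \<open>The mixed terms \<open>2 * c * d * s * t * cos v\<close> of the two real parts
    cancel.\<close>
  have "(c * d + s * t * cos v)\<^sup>2 + (s * t * sin v)\<^sup>2 + ((c * t * cos v - s * d)\<^sup>2 + (c * t * sin v)\<^sup>2)
      = (c\<^sup>2 + s\<^sup>2) * d\<^sup>2 + (c\<^sup>2 + s\<^sup>2) * t\<^sup>2 * ((cos v)\<^sup>2 + (sin v)\<^sup>2)" for c s d t v :: real
    by algebra
  then have "(c * d + s * t * cos v)\<^sup>2 + (s * t * sin v)\<^sup>2 + ((c * t * cos v - s * d)\<^sup>2 + (c * t * sin v)\<^sup>2) = 1"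
    if "c\<^sup>2 + s\<^sup>2 = 1" "d\<^sup>2 + t\<^sup>2 = 1" for c s d t v :: real
    using that by simp
  note unit = this
  define v where "v = u + 2 * pi * \<alpha> * of_int (period y)"
  show ?thesis
    unfolding state_fst_def state_snd_def piece_fst_def piece_snd_def phase_def norm_mult
      norm_cis norm_ii mult_1_right mult_1_left cmod_power2 v_def[symmetric]
    by (simp add: unit)
qed

text \<open>A product of two non-commuting rotations solves the equation because the pulses are
  disjoint: up to offset \<open>3\<close> the second angle is \<open>0\<close>, and from there on
  the first pulse is off. Hence \<open>g1 * t = 0\<close>.\<close>

lemma piece_derivatives:
  assumes h: "h = pulses \<alpha> n (u + \<alpha> * y, y)"
  shows "(piece_fst \<alpha> u n has_vector_derivative - \<i> * cnj h * piece_snd \<alpha> u n y) (at y)"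
    and "(piece_snd \<alpha> u n has_vector_derivative - \<i> * h * piece_fst \<alpha> u n y) (at y)"
proof -
  define v where "v = u + 2 * pi * \<alpha> * of_int n"
  define g1 where "g1 = 3/2 * tent (offset n y - 1)"
  define g2 where "g2 = 3/2 * tent (offset n y - 3)"
  define c s d t where defs: "c = cos (angle 1 n y)" "s = sin (angle 1 n y)"
    "d = cos (angle 3 n y)" "t = sin (angle 3 n y)"
  have "u + \<alpha> * y - \<alpha> * (y - 2 * pi * of_int n) = v" by (simp add: v_def algebra_simps)
  then have h_eq: "h = of_real g1 - of_real g2 * cis (- v)"
    by (simp add: h pulses_def g1_def g2_def algebra_simps)
  have "g1 = 0 \<or> t = 0"
    by (cases "offset n y \<le> 3") (auto simp: g1_def defs tent_eq_0 angle_eq_0)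
  then have separated: "g1 * t = 0" by simp
  have trig: "((\<lambda>y. cos (angle 1 n y)) has_real_derivative - s * g1) (at y)"
    "((\<lambda>y. sin (angle 1 n y)) has_real_derivative c * g1) (at y)"
    "((\<lambda>y. cos (angle 3 n y)) has_real_derivative - t * g2) (at y)"
    "((\<lambda>y. sin (angle 3 n y)) has_real_derivative d * g2) (at y)"
    using DERIV_angle[of 1 n y] DERIV_angle[of 3 n y]
    by (auto intro!: derivative_eq_intros simp: defs g1_def g2_def)
  note products = trig(1)[THEN DERIV_mult', OF trig(3)] trig(2)[THEN DERIV_mult', OF trig(4)]
    trig(1)[THEN DERIV_mult', OF trig(4)] trig(2)[THEN DERIV_mult', OF trig(3)]
  note products' = products[folded defs, THEN has_vector_derivative_of_real]
  define w where "w = cis v"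
  have ii: "\<i> * X * (\<i> * Y * Z) = - (X * Y * Z)" for X Y Z :: complex
    by (simp add: algebra_simps)
  define P where "P = phase \<alpha> u n"
  have w: "w * cis (- v) = 1" by (simp add: w_def cis_mult)
  have separated': "complex_of_real g1 * complex_of_real t = 0"
    using separated by (metis of_real_0 of_real_mult)
  have h_w: "h = of_real g1 - of_real g2 * cis (- v)" "cnj h = of_real g1 - of_real g2 * w"
    by (simp_all add: h_eq w_def cis_cnj)
  have "(piece_fst \<alpha> u n has_vector_derivative
      (of_real (c * (- t * g2) + (- s * g1) * d) + of_real (s * (d * g2) + c * g1 * t) * w) * P) (at y)"
    unfolding piece_fst_def[abs_def] v_def[symmetric] w_def[symmetric] P_def[symmetric]
    by (intro has_vector_derivative_mult_left has_vector_derivative_add products')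
  \<comment> \<open>The discrepancy is a combination of the two vanishing quantities
    \<open>g1 * t\<close> and \<open>1 - w * cis (- v)\<close>.\<close>
  moreover have "(of_real g1 - of_real g2 * w) * (of_real (c * t) * cis (- v) - of_real (s * d))
        - (of_real (c * (- t * g2) + (- s * g1) * d) + of_real (s * (d * g2) + c * g1 * t) * w)
      = of_real c * (of_real g1 * of_real t) * (cis (- v) - w) + of_real (g2 * c * t) * (1 - w * cis (- v))"
    by (simp add: algebra_simps)
  then have "of_real (c * (- t * g2) + (- s * g1) * d) + of_real (s * (d * g2) + c * g1 * t) * w
      = (of_real g1 - of_real g2 * w) * (of_real (c * t) * cis (- v) - of_real (s * d))"
    unfolding w separated' by simp
  then have "(of_real (c * (- t * g2) + (- s * g1) * d) + of_real (s * (d * g2) + c * g1 * t) * w) * P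
      = - \<i> * cnj h * piece_snd \<alpha> u n y"
    unfolding piece_snd_def h_w(2) v_def[symmetric] P_def[symmetric] defs[symmetric] by (simp add: ii)
  ultimately show "(piece_fst \<alpha> u n has_vector_derivative - \<i> * cnj h * piece_snd \<alpha> u n y) (at y)"
    by simp
  have "(piece_snd \<alpha> u n has_vector_derivative
      \<i> * (of_real (c * (d * g2) + (- s * g1) * t) * cis (- v) - of_real (s * (- t * g2) + c * g1 * d)) * P) (at y)"
    unfolding piece_snd_def[abs_def] v_def[symmetric] P_def[symmetric]
    by (intro has_vector_derivative_mult_left has_vector_derivative_mult_right
        has_vector_derivative_diff products')
  \<comment> \<open>Here the sum has to vanish, since the derivative carries the factor
    \<open>\<i>\<close> and the target \<open>- \<i>\<close>.\<close>
  moreover have "(of_real g1 - of_real g2 * cis (- v)) * (of_real (c * d) + of_real (s * t) * w)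
        + (of_real (c * (d * g2) + (- s * g1) * t) * cis (- v) - of_real (s * (- t * g2) + c * g1 * d))
      = of_real s * (of_real g1 * of_real t) * (w - cis (- v)) + of_real (g2 * s * t) * (1 - w * cis (- v))"
    by (simp add: algebra_simps)
  then have "of_real (c * (d * g2) + (- s * g1) * t) * cis (- v) - of_real (s * (- t * g2) + c * g1 * d)
      = - ((of_real g1 - of_real g2 * cis (- v)) * (of_real (c * d) + of_real (s * t) * w))"
    unfolding w separated' by (simp add: eq_neg_iff_add_eq_0 add.commute)
  then have "\<i> * (of_real (c * (d * g2) + (- s * g1) * t) * cis (- v) - of_real (s * (- t * g2) + c * g1 * d)) * P
      = - \<i> * h * piece_fst \<alpha> u n y"
    unfolding piece_fst_def h_w(1) v_def[symmetric] w_def[symmetric] P_def[symmetric] defs[symmetric] by simp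
  ultimately show "(piece_snd \<alpha> u n has_vector_derivative - \<i> * h * piece_fst \<alpha> u n y) (at y)"
    by simp
qed

text \<open>Inside a period the state is a single piece. Near a joint it is constant and the field
  is zero, so no one-sided derivatives have to be matched.\<close>

lemma state_derivatives:
  shows "(state_fst \<alpha> u has_vector_derivative - \<i> * cnj (field \<alpha> (u + \<alpha> * y, y)) * state_snd \<alpha> u y) (at y)"
    and "(state_snd \<alpha> u has_vector_derivative - \<i> * field \<alpha> (u + \<alpha> * y, y) * state_fst \<alpha> u y) (at y)"
proof -
  have op: "open {y. a < offset n y \<and> offset n y < b}" for a b n
    by (intro open_Collect_conj open_Collect_less continuous_intros)
  have "(state_fst \<alpha> u has_vector_derivative - \<i> * cnj (field \<alpha> (u + \<alpha> * y, y)) * state_snd \<alpha> u y) (at y)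
      \<and> (state_snd \<alpha> u has_vector_derivative - \<i> * field \<alpha> (u + \<alpha> * y, y) * state_fst \<alpha> u y) (at y)"
  proof (cases rule: offset_cases[of y])
    case (inner n)
    let ?W = "{y. 0 < offset n y \<and> offset n y < 6}"
    have eq: "state_fst \<alpha> u z = piece_fst \<alpha> u n z" "state_snd \<alpha> u z = piece_snd \<alpha> u n z"
      if "z \<in> ?W" for z
      using that period_eqI[of n z] by (simp_all add: state_fst_def state_snd_def)
    have "field \<alpha> (u + \<alpha> * y, y) = pulses \<alpha> n (u + \<alpha> * y, y)"
      using inner by (simp add: field_inner)
    note pieces = piece_derivatives[OF this]
    show ?thesis
    proof
      show "(state_fst \<alpha> u has_vector_derivative - \<i> * cnj (field \<alpha> (u + \<alpha> * y, y)) * state_snd \<alpha> u y) (at y)"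
        by (rule has_vector_derivative_transform_within_open[OF _ op[of 0 n 6]])
           (use pieces(1) inner eq in auto)
      show "(state_snd \<alpha> u has_vector_derivative - \<i> * field \<alpha> (u + \<alpha> * y, y) * state_fst \<alpha> u y) (at y)"
        by (rule has_vector_derivative_transform_within_open[OF _ op[of 0 n 6]])
           (use pieces(2) inner eq in auto)
    qed
  next
    case (joint n)
    then have "field \<alpha> (u + \<alpha> * y, y) = 0" by (simp add: field_joint)
    moreover have "(state_fst \<alpha> u has_vector_derivative 0) (at y)"
      by (rule has_vector_derivative_transform_within_open
            [OF has_vector_derivative_const[of "phase \<alpha> u n"] op[of "- 1" n 1]])
         (use joint state_joint in auto)
    moreover have "(state_snd \<alpha> u has_vector_derivative 0) (at y)"
      by (rule has_vector_derivative_transform_within_open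
            [OF has_vector_derivative_const[of 0] op[of "- 1" n 1]])
         (use joint state_joint in auto)
    ultimately show ?thesis by simp
  qed
  then show "(state_fst \<alpha> u has_vector_derivative - \<i> * cnj (field \<alpha> (u + \<alpha> * y, y)) * state_snd \<alpha> u y) (at y)"
    and "(state_snd \<alpha> u has_vector_derivative - \<i> * field \<alpha> (u + \<alpha> * y, y) * state_fst \<alpha> u y) (at y)"
    by auto
qed

definition state :: "real \<Rightarrow> real \<Rightarrow> real \<Rightarrow> complex^2^2" where
  "state \<alpha> u y = quat_matrix (state_fst \<alpha> u y) (state_snd \<alpha> u y)"

lemma state_cadjoint: "state \<alpha> u y ** cadjoint (state \<alpha> u y) = mat 1"
  and unitary_state: "unitary_matrix (state \<alpha> u y)"
  using quat_matrix_mult_cadjoint[OF state_norm] by (simp_all add: state_def unitary_matrix_def)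

lemma state_period: "state \<alpha> u (2 * pi * of_int n) = quat_matrix (phase \<alpha> u n) 0"
proof -
  have "offset n (2 * pi * of_int n) = 0" by (simp add: offset_def)
  then show ?thesis by (simp add: state_def state_joint[of n])
qed

text \<open>Along a trajectory on the torus \<open>x - \<alpha> * y\<close> keeps the value
  \<open>u\<close>, so the second angle \<open>y\<close> serves as time; the chain rule supplies the
  factor \<open>\<omega>2\<close>. The adjoint normalises the solution at time
  \<open>s\<close>.\<close>

lemma unitary_propagator_state:
  fixes \<omega>1 \<omega>2 :: real and \<theta> :: "real \<times> real"
  assumes "\<omega>2 \<noteq> 0"
  defines "\<alpha> \<equiv> \<omega>1 / \<omega>2"
  defines "u \<equiv> fst \<theta> - \<alpha> * snd \<theta>"
  shows "unitary_propagator
    (quasiperiodic_hamiltonian (\<lambda>_. 0) (\<lambda>p. \<omega>2 * Re (field \<alpha> p)) (\<lambda>p. \<omega>2 * Im (field \<alpha> p)) (\<lambda>_. 0) \<omega>1 \<omega>2 \<theta>)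
    (\<lambda>t s. state \<alpha> u (\<omega>2 * t + snd \<theta>) ** cadjoint (state \<alpha> u (\<omega>2 * s + snd \<theta>)))"
    (is "unitary_propagator ?H ?U")
  unfolding unitary_propagator_def
proof (intro conjI allI)
  show "unitary_matrix (?U t s)" for t s
    by (intro unitary_matrix_mult_cadjoint unitary_state)
  show "?U s s = mat 1" for s by (rule state_cadjoint)
  fix t s
  define y where "y = \<omega>2 * t + snd \<theta>"
  define h where "h = of_real \<omega>2 * field \<alpha> (u + \<alpha> * y, y)"
  have "((\<lambda>t. \<omega>2 * t + snd \<theta>) has_vector_derivative \<omega>2) (at t)"
    by (auto intro!: derivative_eq_intros)
  note chain = vector_diff_chain_at[OF this, unfolded o_def]
  have a: "((\<lambda>t. state_fst \<alpha> u (\<omega>2 * t + snd \<theta>)) has_vector_derivative - \<i> * cnj h * state_snd \<alpha> u y) (at t)"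
    using chain[OF state_derivatives(1)[of \<alpha> u "\<omega>2 * t + snd \<theta>"]]
    by (simp add: h_def y_def scaleR_conv_of_real mult_ac)
  have b: "((\<lambda>t. state_snd \<alpha> u (\<omega>2 * t + snd \<theta>)) has_vector_derivative - \<i> * h * state_fst \<alpha> u y) (at t)"
    using chain[OF state_derivatives(2)[of \<alpha> u "\<omega>2 * t + snd \<theta>"]]
    by (simp add: h_def y_def scaleR_conv_of_real mult_ac)
  let ?D = "quat_matrix (- \<i> * cnj h * state_snd \<alpha> u y) (- \<i> * h * state_fst \<alpha> u y)"
  have "u + \<alpha> * y = \<omega>1 * t + fst \<theta>"
    using assms(1) by (simp add: u_def y_def \<alpha>_def field_simps)
  then have H: "?H t = 0 *\<^sub>R mat 1 + Re h *\<^sub>R pauli1 + Im h *\<^sub>R pauli2 + 0 *\<^sub>R pauli3"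
    by (simp add: quasiperiodic_hamiltonian_def Let_def h_def y_def)
  show "\<exists>D. ((\<lambda>r. ?U r s) has_vector_derivative D) (at t) \<and> mat \<i> ** D = ?H t ** ?U t s"
  proof (intro exI conjI)
    show "((\<lambda>r. ?U r s) has_vector_derivative ?D ** cadjoint (state \<alpha> u (\<omega>2 * s + snd \<theta>))) (at t)"
      unfolding state_def[of \<alpha> u "\<omega>2 * _ + snd \<theta>"]
      by (intro has_vector_derivative_matrix_mult_right has_vector_derivative_quat_matrix a b)
    show "mat \<i> ** (?D ** cadjoint (state \<alpha> u (\<omega>2 * s + snd \<theta>))) = ?H t ** ?U t s"
      unfolding H matrix_mul_assoc schroedinger_quat_matrix[OF refl refl]
      by (simp add: state_def y_def)
  qed
qed

section \<open>Orbits\<close>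

text \<open>By \<open>state_norm\<close> all matrix entries have modulus at most \<open>1\<close>;
  in finite dimension boundedness yields precompactness.\<close>

lemma bounded_state_orbit: "bounded (range (\<lambda>t. state \<alpha> u (g t) *v \<xi>))"
proof -
  have bound: "norm (state_fst \<alpha> u y) \<le> 1" "norm (state_snd \<alpha> u y) \<le> 1" for y
  proof -
    have "(norm (state_fst \<alpha> u y))\<^sup>2 \<le> 1\<^sup>2" "(norm (state_snd \<alpha> u y))\<^sup>2 \<le> 1\<^sup>2"
      using state_norm[of \<alpha> u y] zero_le_power2[of "norm (state_fst \<alpha> u y)"]
        zero_le_power2[of "norm (state_snd \<alpha> u y)"]
      unfolding one_power2 by linarith+
    then show "norm (state_fst \<alpha> u y) \<le> 1" "norm (state_snd \<alpha> u y) \<le> 1"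
      by (simp_all only: power2_le_imp_le zero_le_one)
  qed
  have "norm (state \<alpha> u y *v \<xi>) \<le> 2 * (norm (\<xi> $ 1) + norm (\<xi> $ 2))" for y
  proof -
    have entry: "norm (a * z + b * z') \<le> norm z + norm z'"
      if "norm a \<le> 1" "norm b \<le> 1" for a b z z' :: complex
      using norm_triangle_ineq[of "a * z" "b * z'"] mult_right_mono[OF that(1), of "norm z"]
        mult_right_mono[OF that(2), of "norm z'"]
      by (simp add: norm_mult)
    have "norm ((state \<alpha> u y *v \<xi>) $ i) \<le> norm (\<xi> $ 1) + norm (\<xi> $ 2)" for i
    proof -
      have "norm ((state \<alpha> u y *v \<xi>) $ 1) \<le> norm (\<xi> $ 1) + norm (\<xi> $ 2)"
        using entry[of "state_fst \<alpha> u y" "- cnj (state_snd \<alpha> u y)" "\<xi> $ 1" "\<xi> $ 2"] bound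
        by (simp add: state_def quat_matrix_def matrix_vector_mult_def sum_2)
      moreover have "norm ((state \<alpha> u y *v \<xi>) $ 2) \<le> norm (\<xi> $ 1) + norm (\<xi> $ 2)"
        using entry[of "state_snd \<alpha> u y" "cnj (state_fst \<alpha> u y)" "\<xi> $ 1" "\<xi> $ 2"] bound
        by (simp add: state_def quat_matrix_def matrix_vector_mult_def sum_2)
      ultimately show ?thesis using exhaust_2[of i] by auto
    qed
    then have "(\<Sum>i\<in>UNIV. norm ((state \<alpha> u y *v \<xi>) $ i)) \<le> (\<Sum>i\<in>(UNIV::2 set). norm (\<xi> $ 1) + norm (\<xi> $ 2))"
      by (rule sum_mono)
    then show ?thesis
      using L2_set_le_sum[of UNIV "\<lambda>i. norm ((state \<alpha> u y *v \<xi>) $ i)"]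
      by (simp add: norm_vec_def sum_2)
  qed
  then show ?thesis by (auto intro!: boundedI)
qed

lemma precompact_if_bounded:
  fixes S :: "'a::heine_borel set"
  shows "bounded S \<Longrightarrow> precompact S"
  by (simp add: precompact_def compact_eq_bounded_closed bounded_closure)

text \<open>The quotient of the phases at \<open>k + p\<close> and \<open>k\<close> is
  \<open>c * w ^ k\<close>. If it stayed near \<open>1\<close>, all powers of \<open>w\<close>
  would, forcing \<open>w = 1\<close> and thus \<open>\<alpha> * p\<close> to be an integer.\<close>

lemma phase_quotient_not_near_one:
  assumes "\<alpha> \<notin> \<rat>" and "p \<noteq> 0"
  shows "\<exists>k::nat. norm (phase \<alpha> u (int k + p) - phase \<alpha> u (int k)) \<ge> 1/4"
proof (rule ccontr)
  assume "\<not> ?thesis"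
  then have near: "norm (phase \<alpha> u (int k + p) - phase \<alpha> u (int k)) < 1/4" for k :: nat
    by (simp add: not_le)
  define c where "c = phase \<alpha> u p"
  define w where "w = cis (2 * pi * \<alpha> * of_int p)"
  have c_near: "norm (c * w ^ k - 1) < 1/4" for k
  proof -
    have "c * w ^ k = cis (of_int p * u + pi * \<alpha> * of_int p * (of_int p - 1) + k * (2 * pi * \<alpha> * of_int p))"
      by (simp add: c_def phase_def w_def Complex.DeMoivre cis_mult)
    then have "phase \<alpha> u (int k + p) = phase \<alpha> u (int k) * (c * w ^ k)"
      by (simp add: phase_def cis_mult algebra_simps)
    then have "phase \<alpha> u (int k + p) - phase \<alpha> u (int k) = phase \<alpha> u (int k) * (c * w ^ k - 1)"
      by (simp add: algebra_simps)
    then have "norm (phase \<alpha> u (int k + p) - phase \<alpha> u (int k)) = norm (c * w ^ k - 1)"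
      by (simp add: norm_mult phase_def)
    then show ?thesis using near[of k] by simp
  qed
  \<comment> \<open>Comparison with \<open>k = 0\<close> eliminates the unimodular constant
    \<open>c\<close>; the two errors \<open>1/4\<close> add up to the threshold
    \<open>1/2\<close>.\<close>
  have "norm (w ^ k - 1) < 1/2" for k
  proof -
    have "norm (w ^ k - 1) = norm (c * (w ^ k - 1))" by (simp add: norm_mult c_def phase_def)
    also have "\<dots> = norm ((c * w ^ k - 1) - (c * w ^ 0 - 1))" by (simp add: algebra_simps)
    also have "\<dots> \<le> norm (c * w ^ k - 1) + norm (c * w ^ 0 - 1)" by (rule norm_triangle_ineq4)
    also have "\<dots> < 1/2" using c_near[of k] c_near[of 0] by simp
    finally show ?thesis .
  qed
  then have "w = 1" by (rule powers_near_one_imp_one)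
  then have "cos (2 * pi * \<alpha> * of_int p) = 1" unfolding w_def by (metis cis.sel(1) one_complex.sel(1))
  then obtain m :: int where "2 * pi * \<alpha> * of_int p = of_int m * 2 * pi"
    using cos_one_2pi_int by auto
  then have "\<alpha> * of_int p = of_int m" by simp
  then have "\<alpha> = of_int m / of_int p" using \<open>p \<noteq> 0\<close> by (simp add: field_simps)
  then show False using \<open>\<alpha> \<notin> \<rat>\<close> by auto
qed

text \<open>At multiples of the period the state is diagonal, so one nonzero component of
  \<open>\<xi>\<close> already exhibits the quadratic phase.\<close>

lemma state_orbit_not_almost_periodic:
  assumes "\<alpha> \<notin> \<rat>" and "\<omega> \<noteq> 0" and "\<xi> \<noteq> 0"
  shows "\<not> almost_periodic (\<lambda>t. state \<alpha> u (\<omega> * t) *v \<xi>)"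
proof
  let ?f = "\<lambda>t. state \<alpha> u (\<omega> * t) *v \<xi>"
  assume ap: "almost_periodic ?f"
  obtain i where i: "\<xi> $ i \<noteq> 0" using \<open>\<xi> \<noteq> 0\<close> by (auto simp: vec_eq_iff)
  then have "norm (\<xi> $ i) / 4 > 0" by simp
  from almost_periodic_obtain_multiple[OF ap this, of "2 * pi / \<omega>"]
  obtain p where "p \<noteq> 0"
    and p: "\<And>t. norm (?f (t + of_int p * (2 * pi / \<omega>)) - ?f t) < norm (\<xi> $ i) / 4" by blast
  obtain k :: nat where k: "norm (phase \<alpha> u (int k + p) - phase \<alpha> u (int k)) \<ge> 1/4" (is "norm ?d \<ge> _")
    using phase_quotient_not_near_one[OF \<open>\<alpha> \<notin> \<rat>\<close> \<open>p \<noteq> 0\<close>] by blast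
  define t where "t = 2 * pi / \<omega> * of_int (int k)"
  have "\<omega> * (t + of_int p * (2 * pi / \<omega>)) = 2 * pi * of_int (int k + p)"
    "\<omega> * t = 2 * pi * of_int (int k)"
    using \<open>\<omega> \<noteq> 0\<close> by (simp_all add: t_def field_simps)
  then have eq: "?f (t + of_int p * (2 * pi / \<omega>)) = quat_matrix (phase \<alpha> u (int k + p)) 0 *v \<xi>"
    "?f t = quat_matrix (phase \<alpha> u (int k)) 0 *v \<xi>"
    by (simp_all only: state_period)
  \<comment> \<open>The second component evolves by the conjugate phase, whose increments have the
    same modulus.\<close>
  have "norm ((?f (t + of_int p * (2 * pi / \<omega>)) - ?f t) $ i) = norm ?d * norm (\<xi> $ i)"
    unfolding eq using exhaust_2[of i]
    by (auto simp: quat_matrix_def matrix_vector_mult_def sum_2 norm_mult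
        simp flip: left_diff_distrib complex_cnj_diff)
  also have "\<dots> \<ge> 1/4 * norm (\<xi> $ i)" using k by (rule mult_right_mono) simp
  finally show False
    using p[of t] Finite_Cartesian_Product.norm_nth_le[of "?f (t + of_int p * (2 * pi / \<omega>)) - ?f t" i] by simp
qed

theorem mainTheorem2:
  fixes \<omega>1 \<omega>2 \<alpha> T2 :: real
  assumes "\<omega>1 > 0" and "\<omega>2 > 0"
    and "\<alpha> = \<omega>1 / \<omega>2" and "\<alpha> \<notin> \<rat>"
    and "T2 = 2 * pi / \<omega>2"
  shows "\<exists>h0 h1 h2 h3 :: real \<times> real \<Rightarrow> real.
    torus_function h0 \<and> torus_function h1 \<and> torus_function h2 \<and> torus_function h3 \<and>
    (\<exists>U :: real \<times> real \<Rightarrow> real \<Rightarrow> real \<Rightarrow> complex^2^2.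
      (\<forall>\<theta>. unitary_propagator (quasiperiodic_hamiltonian h0 h1 h2 h3 \<omega>1 \<omega>2 \<theta>) (U \<theta>)) \<and>
      (\<forall>\<theta>1. U (\<theta>1, 0) T2 0 =
         vector [vector [exp (\<i> * of_real \<theta>1), 0],
                 vector [0, exp (- \<i> * of_real \<theta>1)]]) \<and>
      (\<forall>\<theta>1. \<forall>\<xi> :: complex^2. \<xi> \<noteq> 0 \<longrightarrow>
         precompact (range (\<lambda>t. U (\<theta>1, 0) t 0 *v \<xi>)) \<and>
         \<not> almost_periodic (\<lambda>t. U (\<theta>1, 0) t 0 *v \<xi>)))"
proof -
  define U where "U \<theta> t s = state \<alpha> (fst \<theta> - \<alpha> * snd \<theta>) (\<omega>2 * t + snd \<theta>)
    ** cadjoint (state \<alpha> (fst \<theta> - \<alpha> * snd \<theta>) (\<omega>2 * s + snd \<theta>))" for \<theta> t s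
  \<comment> \<open>For zero second angle the solution already starts at the identity, so the
    propagator from time \<open>0\<close> is \<open>state\<close> itself.\<close>
  have "state \<alpha> u 0 = mat 1" for u
    using state_period[of \<alpha> u 0] by (simp add: phase_def quat_matrix_1_0)
  then have "cadjoint (state \<alpha> u 0) = mat 1" for u
    using state_cadjoint[of \<alpha> u 0] by simp
  then have U_0: "U (\<theta>1, 0) t 0 = state \<alpha> \<theta>1 (\<omega>2 * t)" for \<theta>1 t
    by (simp add: U_def)
  show ?thesis
  \<comment> \<open>The field has no \<open>I\<close> or \<open>\<sigma>3\<close> component; the
    factor \<open>\<omega>2\<close> converts the derivative in \<open>y\<close> to one in
    time.\<close>
  proof (rule exI[of _ "\<lambda>_. 0"], rule exI[of _ "\<lambda>p. \<omega>2 * Re (field \<alpha> p)"],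
      rule exI[of _ "\<lambda>p. \<omega>2 * Im (field \<alpha> p)"], rule exI[of _ "\<lambda>_. 0"], intro conjI)
    show "torus_function (\<lambda>_. 0)" "torus_function (\<lambda>_. 0)" by (simp_all add: torus_function_def)
    show "torus_function (\<lambda>p. \<omega>2 * Re (field \<alpha> p))" "torus_function (\<lambda>p. \<omega>2 * Im (field \<alpha> p))"
      unfolding torus_function_def field_periodic
      by (auto intro!: continuous_intros continuous_field)
    show "\<exists>U. (\<forall>\<theta>. unitary_propagator (quasiperiodic_hamiltonian (\<lambda>_. 0) (\<lambda>p. \<omega>2 * Re (field \<alpha> p))
          (\<lambda>p. \<omega>2 * Im (field \<alpha> p)) (\<lambda>_. 0) \<omega>1 \<omega>2 \<theta>) (U \<theta>)) \<and>
      (\<forall>\<theta>1. U (\<theta>1, 0) T2 0 = vector [vector [exp (\<i> * of_real \<theta>1), 0],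
                 vector [0, exp (- \<i> * of_real \<theta>1)]]) \<and>
      (\<forall>\<theta>1. \<forall>\<xi> :: complex^2. \<xi> \<noteq> 0 \<longrightarrow> precompact (range (\<lambda>t. U (\<theta>1, 0) t 0 *v \<xi>)) \<and>
         \<not> almost_periodic (\<lambda>t. U (\<theta>1, 0) t 0 *v \<xi>))"
    proof (intro exI[of _ U] conjI allI impI)
      show "unitary_propagator (quasiperiodic_hamiltonian (\<lambda>_. 0) (\<lambda>p. \<omega>2 * Re (field \<alpha> p))
          (\<lambda>p. \<omega>2 * Im (field \<alpha> p)) (\<lambda>_. 0) \<omega>1 \<omega>2 \<theta>) (U \<theta>)" for \<theta>
        using unitary_propagator_state[of \<omega>2 \<omega>1 \<theta>] assms by (simp add: U_def[abs_def])
      \<comment> \<open>After one period the quadratic term \<open>n * (n - 1)\<close> is still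
        zero, so the phase is exactly \<open>cis \<theta>1\<close>.\<close>
      have "\<omega>2 * T2 = 2 * pi * of_int 1" using assms by simp
      then have "U (\<theta>1, 0) T2 0 = quat_matrix (phase \<alpha> \<theta>1 1) 0" for \<theta>1
        by (simp only: U_0 state_period)
      then show "U (\<theta>1, 0) T2 0 = vector [vector [exp (\<i> * of_real \<theta>1), 0],
                 vector [0, exp (- \<i> * of_real \<theta>1)]]" for \<theta>1
        by (simp add: quat_matrix_def phase_def cis_conv_exp exp_cnj)
      fix \<theta>1 and \<xi> :: "complex^2" assume "\<xi> \<noteq> 0"
      show "precompact (range (\<lambda>t. U (\<theta>1, 0) t 0 *v \<xi>))"
        unfolding U_0 by (intro precompact_if_bounded bounded_state_orbit)
      show "\<not> almost_periodic (\<lambda>t. U (\<theta>1, 0) t 0 *v \<xi>)"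
        unfolding U_0 using assms \<open>\<xi> \<noteq> 0\<close> by (intro state_orbit_not_almost_periodic) auto
    qed
  qed
qed

end
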